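(* Let $A\in\mathbb{R}^{n\times n}$, $B\in\mathbb{R}^{n\times m}$, $C\in\mathbb{R}^{p\times n}$, let $q\ge 0$ be an integer, and let $(K^{(t)})_{t=0,1,2,\dots}$ be an output-feedback control law, i.e. $K^{(t)}:(\mathbb{R}^p)^{t+1}\to\mathbb{R}^m$ is an arbitrary map for each $t$. Suppose there are constants $\kappa>0$ and $0\le\alpha<1$ with $$\alpha<\min\{|\lambda| : \lambda \text{ is an eigenvalue of } A\}$$ such that, for every $x^{(0)}\in\mathbb{R}^n$ and every sequence $(e^{(t)})_{t\ge 0}$ in $\mathbb{R}^p$ for which there is a set $S\subset\{1,\dots,p\}$ with $|S|\le q$ and $\mathrm{supp}(e^{(t)})\subset S$ for all $t\ge 0$, the sequence $(x^{(t)})_{t\ge0}$ defined by $$x^{(t+1)}=Ax^{(t)}+BK^{(t)}(y^{(0)},\dots,y^{(t)}),\qquad y^{(t)}=Cx^{(t)}+e^{(t)}$$ satisfies $\|x^{(t)}\|\le\kappa\,\alpha^t\,\|x^{(0)}\|$ for all $t\ge 0$. Then $q$ errors are correctable after $n$ steps for this control system.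
   Context: For $x\in\mathbb{R}^p$, $\mathrm{supp}(x)=\{i : x_i\neq 0\}$. The vector $e^{(t)}$ models attacks on sensors; its values are arbitrary real numbers on a fixed (unknown) set of attacked sensors. For an integer $T\ge 1$, let $E_{q,T}$ be the set of sequences $(e^{(0)},\dots,e^{(T-1)})\in(\mathbb{R}^p)^T$ for which there is $S\subset\{1,\dots,p\}$ with $|S|\le q$ and $\mathrm{supp}(e^{(t)})\subset S$ for all $t\in\{0,\dots,T-1\}$. Consider the control system $x^{(t+1)}=Ax^{(t)}+BK^{(t)}(y^{(0)},\dots,y^{(t)})$, $y^{(t)}=Cx^{(t)}+e^{(t)}$, and let $y(t,x^{(0)},e)$ denote its output at time $t$ when the initial state is $x^{(0)}$ and the attack sequence is $e$. We say that $q$ errors are correctable after $T$ steps for this control system if there is a function $D:(\mathbb{R}^p)^T\to\mathbb{R}^n$ such that $D\big(y(0,x^{(0)},e),\dots,y(T-1,x^{(0)},e)\big)=x^{(0)}$ for every $x^{(0)}\in\mathbb{R}^n$ and every $e\in E_{q,T}$. The norm $\|\cdot\|$ is any fixed norm on $\mathbb{R}^n$; the convention $0^0=1$ is used. *)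

theory Defs
  imports "HOL-Analysis.Analysis"
begin

definition supp :: "real ^ 'p \<Rightarrow> 'p set" where
  "supp x = {i. x $ i \<noteq> 0}"

definition is_norm :: "('a::real_vector \<Rightarrow> real) \<Rightarrow> bool" where
  "is_norm N \<longleftrightarrow>
     (\<forall>x. N x \<ge> 0) \<and> (\<forall>x. N x = 0 \<longleftrightarrow> x = 0) \<and>
     (\<forall>c x. N (c *\<^sub>R x) = \<bar>c\<bar> * N x) \<and> (\<forall>x y. N (x + y) \<le> N x + N y)"

text \<open>The eigenvalues of a real matrix are the complex ones; this set is finite and nonempty.\<close>

definition eigenvalues :: "real ^ 'n ^ 'n \<Rightarrow> complex set" where
  "eigenvalues A =
     {l. \<exists>v. v \<noteq> 0 \<and> map_matrix complex_of_real A *v v = l *s v}"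

text \<open>A tuple in a power of the output space is a list of that length: the map \<open>K t\<close> is only
  ever applied to the list of the \<open>t + 1\<close> outputs at times \<open>0, \<dots>, t\<close>, and its
  values on lists of other lengths are irrelevant.\<close>

fun sys_state ::
  "real ^ 'n ^ 'n \<Rightarrow> real ^ 'm ^ 'n \<Rightarrow> real ^ 'n ^ 'p \<Rightarrow> (nat \<Rightarrow> (real ^ 'p) list \<Rightarrow> real ^ 'm)
    \<Rightarrow> real ^ 'n \<Rightarrow> (nat \<Rightarrow> real ^ 'p) \<Rightarrow> nat \<Rightarrow> real ^ 'n" where
  "sys_state A B C K x0 e 0 = x0"
| "sys_state A B C K x0 e (Suc t) =
     A *v sys_state A B C K x0 e t
     + B *v K t (map (\<lambda>s. C *v sys_state A B C K x0 e s + e s) [0..<Suc t])"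

definition sys_output ::
  "real ^ 'n ^ 'n \<Rightarrow> real ^ 'm ^ 'n \<Rightarrow> real ^ 'n ^ 'p \<Rightarrow> (nat \<Rightarrow> (real ^ 'p) list \<Rightarrow> real ^ 'm)
    \<Rightarrow> real ^ 'n \<Rightarrow> (nat \<Rightarrow> real ^ 'p) \<Rightarrow> nat \<Rightarrow> real ^ 'p" where
  "sys_output A B C K x0 e t = C *v sys_state A B C K x0 e t + e t"

definition attack_seqs :: "nat \<Rightarrow> nat \<Rightarrow> (real ^ 'p) list set" where
  "attack_seqs q T =
     {es. length es = T \<and> (\<exists>S. card S \<le> q \<and> (\<forall>t<T. supp (es ! t) \<subseteq> S))}"

text \<open>Below, only the outputs at times \<open>t < T\<close> occur. They depend only on the attack values
  at times \<open>s \<le> t\<close>, so the entries of \<open>es\<close> beyond its length play no role.\<close>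

definition errors_correctable ::
  "real ^ 'n ^ 'n \<Rightarrow> real ^ 'm ^ 'n \<Rightarrow> real ^ 'n ^ 'p \<Rightarrow> (nat \<Rightarrow> (real ^ 'p) list \<Rightarrow> real ^ 'm)
    \<Rightarrow> nat \<Rightarrow> nat \<Rightarrow> bool" where
  "errors_correctable A B C K q T \<longleftrightarrow>
     (\<exists>D :: (real ^ 'p) list \<Rightarrow> real ^ 'n. \<forall>x0. \<forall>es \<in> attack_seqs q T.
        D (map (sys_output A B C K x0 (\<lambda>t. es ! t)) [0..<T]) = x0)"

end

theory Submission
  imports Defs "HOL-Computational_Algebra.Fundamental_Theorem_Algebra"
begin

text \<open>
  Suppose that two initial states with admissible attacks produce the same outputs up to time
  \<open>n - 1\<close>, and let \<open>d\<close> be the difference of the initial states. The inputs agree, so the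
  states differ by \<open>A\<^sup>t d\<close>, and \<open>C A\<^sup>t d\<close> is supported on the union of the two attack sets for
  \<open>t < n\<close>, hence for all \<open>t\<close>, because the vectors \<open>A\<^sup>t d\<close> with \<open>t < n\<close> span an \<open>A\<close>-invariant
  space. Both attacks can therefore be prolonged so that the outputs agree forever. Then
  \<open>A\<^sup>t d = O(\<alpha>\<^sup>t)\<close>. Applying to \<open>d\<close> a suitable factor of an annihilating polynomial of \<open>A\<close>, one
  would obtain from \<open>d \<noteq> 0\<close> an eigenvector with the same decay, contradicting \<open>\<alpha> < \<bar>\<lambda>\<bar>\<close>.
\<close>

section \<open>Krylov spaces\<close>

text \<open>Otherwise each new term raises the dimension by one, and the first
  \<open>DIM('a) + 1\<close> terms exceed the whole space. Used for orbits of vectors and for powers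
  of a matrix.\<close>

lemma exists_in_span_of_predecessors:
  fixes f :: "nat \<Rightarrow> 'a :: euclidean_space"
  shows "\<exists>k \<le> DIM('a). f k \<in> span (f ` {..<k})"
proof (rule ccontr)
  assume "\<not> ?thesis"
  then have new: "f k \<notin> span (f ` {..<k})" if "k \<le> DIM('a)" for k
    using that by blast
  have "dim (f ` {..<k}) = k" if "k \<le> Suc DIM('a)" for k
    using that
  proof (induction k)
    case 0
    then show ?case by simp
  next
    case (Suc k)
    then show ?case
      using new[of k] by (simp add: lessThan_Suc dim_insert)
  qed
  from this[of "Suc DIM('a)"] show False
    using dim_subset_UNIV[of "f ` {..<Suc DIM('a)}"] by simp
qed

text \<open>Some \<open>f k\<close> with k at most n depends linearly on its predecessors. Their
  span is invariant: A maps each generator to the next one, and the last to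
  \<open>f k\<close>.\<close>

lemma orbit_in_subspace:
  fixes A :: "real ^ 'n ^ 'n"
  assumes V: "subspace V"
    and init: "\<And>t. t < CARD('n) \<Longrightarrow> ((*v) A ^^ t) d \<in> V"
  shows "((*v) A ^^ t) d \<in> V"
proof -
  define f where "f = (\<lambda>t. ((*v) A ^^ t) d)"
  obtain k where k: "k \<le> CARD('n)" "f k \<in> span (f ` {..<k})"
    using exists_in_span_of_predecessors[of f] by auto
  have inv: "A *v x \<in> span (f ` {..<k})" if "x \<in> span (f ` {..<k})" for x
  proof -
    have "A *v x \<in> span ((*v) A ` f ` {..<k})"
      using that by (simp add: linear_span_image)
    also have "(*v) A ` f ` {..<k} \<subseteq> span (f ` {..<k})"
    proof clarsimp
      fix i assume "i < k"
      have "A *v f i = f (Suc i)" by (simp add: f_def)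
      then show "A *v f i \<in> span (f ` {..<k})"
        using \<open>i < k\<close> k(2) by (cases "Suc i = k") (auto intro: span_base)
    qed
    then have "span ((*v) A ` f ` {..<k}) \<subseteq> span (f ` {..<k})"
      by (simp add: span_minimal)
    finally show ?thesis .
  qed
  have "f t \<in> span (f ` {..<k})" for t
  proof (induction t)
    case 0
    then show ?case
      using k(2) by (cases "k = 0") (auto intro: span_base)
  next
    case (Suc t)
    have "f (Suc t) = A *v f t" by (simp add: f_def)
    then show ?case using inv[OF Suc] by simp
  qed
  moreover have "span (f ` {..<k}) \<subseteq> V"
    using V init k(1) by (intro span_minimal) (auto simp: f_def)
  ultimately show ?thesis by (auto simp: f_def)
qed

section \<open>Polynomials of a matrix\<close>

text \<open>The vector p(M) v, evaluated by Horner's scheme.\<close>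

definition poly_vec :: "complex ^ 'n ^ 'n \<Rightarrow> complex poly \<Rightarrow> complex ^ 'n \<Rightarrow> complex ^ 'n" where
  "poly_vec M p v = fold_coeffs (\<lambda>a w. a *s v + M *v w) p 0"

lemma poly_vec_0 [simp]: "poly_vec M 0 v = 0"
  by (simp add: poly_vec_def)

lemma poly_vec_pCons [simp]: "poly_vec M (pCons a p) v = a *s v + M *v poly_vec M p v"
  by (cases "p = 0 \<and> a = 0") (auto simp: poly_vec_def)

lemma poly_vec_add: "poly_vec M (p + q) v = poly_vec M p v + poly_vec M q v"
  by (induction p q rule: poly_induct2)
    (simp_all add: matrix_vector_right_distrib vector_sadd_rdistrib algebra_simps)

lemma poly_vec_smult: "poly_vec M (smult c p) v = c *s poly_vec M p v"
  by (induction p)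
    (simp_all add: vector_add_ldistrib vector_smult_assoc vector_scalar_commute)

lemma poly_vec_diff: "poly_vec M (p - q) v = poly_vec M p v - poly_vec M q v"
  using poly_vec_add[of M "p - q" q v] by simp

lemma poly_vec_monom: "poly_vec M (monom c k) v = c *s ((*v) M ^^ k) v"
  by (induction k) (simp_all add: monom_0 monom_Suc vector_scalar_commute)

lemma poly_vec_mult_linear:
  "poly_vec M ([:- l, 1:] * p) v = M *v poly_vec M p v - l *s poly_vec M p v"
  by (simp add: poly_vec_add poly_vec_smult poly_vec_diff)

lemma poly_vec_eigenvector:
  assumes "M *v v = l *s v"
  shows "poly_vec M p v = poly p l *s v"
  by (induction p)
    (simp_all add: assms vector_scalar_commute vector_smult_assoc vector_sadd_rdistrib mult.commute)

text \<open>The matrices form a finite-dimensional real space, so some power of M is a combination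
  of lower ones.\<close>

lemma annihilating_poly_exists:
  fixes M :: "complex ^ 'n ^ 'n"
  obtains p where "p \<noteq> 0" "\<And>v. poly_vec M p v = 0"
proof -
  define f where "f = (\<lambda>i. ((**) M ^^ i) (mat 1))"
  have f: "f i *v v = ((*v) M ^^ i) v" for i v
    by (induction i) (simp_all add: f_def matrix_vector_mul_assoc[symmetric])
  obtain k where k: "f k \<in> span (f ` {..<k})"
    using exists_in_span_of_predecessors[of f] by auto
  \<comment> \<open>The matrices that act as a polynomial in M of degree below k. The degree bound
    gives \<open>monom 1 k - p\<close> the coefficient 1 at k, so it is nonzero.\<close>
  define Q where "Q = {X. \<exists>p. (\<forall>i\<ge>k. coeff p i = 0) \<and> (\<forall>v. X *v v = poly_vec M p v)}"
  have "subspace Q"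
    unfolding subspace_def
  proof (intro conjI ballI allI)
    show "0 \<in> Q"
      unfolding Q_def by (auto intro!: exI[of _ 0])
  next
    fix X Y assume "X \<in> Q" "Y \<in> Q"
    then obtain p q where
      "\<forall>i\<ge>k. coeff p i = 0" "\<forall>v. X *v v = poly_vec M p v"
      "\<forall>i\<ge>k. coeff q i = 0" "\<forall>v. Y *v v = poly_vec M q v"
      unfolding Q_def by auto
    then show "X + Y \<in> Q"
      unfolding Q_def
      by (auto intro!: exI[of _ "p + q"] simp: poly_vec_add matrix_vector_mult_add_rdistrib)
  next
    fix c :: real and X assume "X \<in> Q"
    then obtain p where "\<forall>i\<ge>k. coeff p i = 0" and p: "\<forall>v. X *v v = poly_vec M p v"
      unfolding Q_def by auto
    moreover have "(c *\<^sub>R X) *v v = of_real c *s (X *v v)" for v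
      by (simp add: vec_eq_iff matrix_vector_mult_def sum_distrib_left
          scaleR_conv_of_real[where 'a = complex] mult.assoc)
    ultimately show "c *\<^sub>R X \<in> Q"
      unfolding Q_def
      by (auto intro!: exI[of _ "smult (of_real c) p"] simp: poly_vec_smult)
  qed
  moreover have "f ` {..<k} \<subseteq> Q"
  proof clarify
    fix i assume "i < k"
    then show "f i \<in> Q"
      unfolding Q_def by (auto simp: f poly_vec_monom intro!: exI[of _ "monom 1 i"])
  qed
  ultimately have "f k \<in> Q"
    using k span_minimal by blast
  then obtain p where p: "\<forall>i\<ge>k. coeff p i = 0" "\<forall>v. f k *v v = poly_vec M p v"
    unfolding Q_def by auto
  show thesis
  proof (rule that[of "monom 1 k - p"])
    have "coeff (monom 1 k - p) k = 1"
      using p(1) by simp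
    then show "monom 1 k - p \<noteq> 0" by force
    show "poly_vec M (monom 1 k - p) v = 0" for v
      using p(2) by (simp add: poly_vec_diff poly_vec_monom f)
  qed
qed

text \<open>All eigenvalues are roots of one nonzero annihilating polynomial. Finiteness makes
  \<open>Min\<close> over their moduli a genuine lower bound.\<close>

lemma finite_eigenvalues: "finite (eigenvalues A)"
proof -
  obtain p where p: "p \<noteq> 0" "\<And>v. poly_vec (map_matrix complex_of_real A) p v = 0"
    using annihilating_poly_exists[of "map_matrix complex_of_real A"] by metis
  have "poly p l = 0" if "l \<in> eigenvalues A" for l
  proof -
    obtain v where "v \<noteq> 0" "map_matrix complex_of_real A *v v = l *s v"
      using \<open>l \<in> eigenvalues A\<close> by (auto simp: eigenvalues_def)
    then show ?thesis
      using poly_vec_eigenvector[of "map_matrix complex_of_real A" v l p] p(2)[of v] by simp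
  qed
  then have "eigenvalues A \<subseteq> {l. poly p l = 0}"
    by blast
  then show ?thesis
    using poly_roots_finite[OF p(1)] finite_subset by blast
qed

section \<open>Orbits that decay faster than every eigenvalue\<close>

text \<open>F stands in for a norm on the complex space. Homogeneity is relaxed by a factor c
  because the F built below from a norm on the real space satisfies it only up to a
  constant.\<close>

context
  fixes M :: "complex ^ 'n ^ 'n" and F :: "complex ^ 'n \<Rightarrow> real" and a c :: real
  assumes F_add: "\<And>x y. F (x + y) \<le> F x + F y"
    and F_scale: "\<And>z x. F (z *s x) \<le> c * cmod z * F x"
    and F_pos: "\<And>x. x \<noteq> 0 \<Longrightarrow> F x > 0"
    and F_0: "F 0 = 0"
    and c_nonneg: "c \<ge> 0" and a_nonneg: "a \<ge> 0"
begin

text \<open>Applying M shifts the orbit by one step, which only multiplies the bound by a; so each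
  Horner step keeps the rate.\<close>

lemma decay_poly_vec:
  assumes "\<And>t. F (((*v) M ^^ t) w) \<le> b * a ^ t"
  shows "\<exists>b'. \<forall>t. F (((*v) M ^^ t) (poly_vec M p w)) \<le> b' * a ^ t"
proof (induction p)
  case 0
  have "((*v) M ^^ t) 0 = 0" for t
    by (induction t) simp_all
  then show ?case by (auto simp: F_0 intro!: exI[of _ 0])
next
  case (pCons z p)
  then obtain b' where b': "\<And>t. F (((*v) M ^^ t) (poly_vec M p w)) \<le> b' * a ^ t"
    by auto
  have split: "((*v) M ^^ t) (z *s w + M *v u) = z *s ((*v) M ^^ t) w + ((*v) M ^^ Suc t) u" for t u
    by (induction t) (simp_all add: matrix_vector_right_distrib vector_scalar_commute)
  have "F (((*v) M ^^ t) (poly_vec M (pCons z p) w)) \<le> (c * cmod z * b + b' * a) * a ^ t" for t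
  proof -
    have "F (((*v) M ^^ t) (poly_vec M (pCons z p) w))
        \<le> F (z *s ((*v) M ^^ t) w) + F (((*v) M ^^ Suc t) (poly_vec M p w))"
      unfolding poly_vec_pCons split by (rule F_add)
    also have "\<dots> \<le> c * cmod z * (b * a ^ t) + b' * a ^ Suc t"
      using order_trans[OF F_scale mult_left_mono[OF assms]] c_nonneg b'[of "Suc t"]
      by (intro add_mono) auto
    finally show ?thesis by (simp add: algebra_simps)
  qed
  then show ?case by blast
qed

text \<open>Dividing the orbit by \<open>l ^ t\<close> recovers u, so F u is bounded by a multiple
  of \<open>(a / cmod l) ^ t\<close>, which tends to 0.\<close>

lemma decaying_eigenvector_0:
  assumes "M *v u = l *s u" and "a < cmod l"
    and decay: "\<And>t. F (((*v) M ^^ t) u) \<le> b * a ^ t"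
  shows "u = 0"
proof (rule ccontr)
  assume "u \<noteq> 0"
  have l: "cmod l > 0" using assms(2) a_nonneg by linarith
  have orbit: "((*v) M ^^ t) u = l ^ t *s u" for t
    by (induction t) (simp_all add: assms(1) vector_scalar_commute vector_smult_assoc mult.commute)
  have "F u \<le> c * b * (a / cmod l) ^ t" for t
  proof -
    have "F u = F ((1 / l ^ t) *s ((*v) M ^^ t) u)"
      using l by (simp add: orbit vector_smult_assoc)
    also have "\<dots> \<le> c * cmod (1 / l ^ t) * F (((*v) M ^^ t) u)"
      by (rule F_scale)
    also have "\<dots> \<le> c * cmod (1 / l ^ t) * (b * a ^ t)"
      using decay c_nonneg by (intro mult_left_mono) auto
    finally show ?thesis by (simp add: norm_divide norm_power power_divide algebra_simps)
  qed
  moreover have "(\<lambda>t. c * b * (a / cmod l) ^ t) \<longlonglongrightarrow> c * b * 0"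
    using a_nonneg l assms(2) by (intro tendsto_intros LIMSEQ_power_zero) auto
  ultimately have "F u \<le> 0"
    using LIMSEQ_le_const by fastforce
  then show False using F_pos[OF \<open>u \<noteq> 0\<close>] by linarith
qed

text \<open>Induction on the degree: if p = (X - l) q, then M - l kills q(M) w, which also decays.
  Being no eigenvector, it is 0, and q replaces p.\<close>

lemma decaying_orbit_0:
  assumes eig: "\<And>l v. v \<noteq> 0 \<Longrightarrow> M *v v = l *s v \<Longrightarrow> a < cmod l"
    and decay: "\<And>t. F (((*v) M ^^ t) w) \<le> b * a ^ t"
    and "p \<noteq> 0" and "poly_vec M p w = 0"
  shows "w = 0"
  using assms(3,4)
proof (induction "degree p" arbitrary: p)
  case 0
  then obtain z where "p = [:z:]" "z \<noteq> 0"
    by (metis degree_eq_zeroE pCons_eq_0_iff)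
  then show ?case using 0 by simp
next
  case (Suc k)
  then have "\<not> constant (poly p)"
    by (simp add: constant_degree)
  then obtain l where "poly p l = 0"
    using fundamental_theorem_of_algebra by blast
  then obtain q where q: "p = [:- l, 1:] * q"
    by (auto simp: poly_eq_0_iff_dvd)
  then have "q \<noteq> 0" using Suc.prems by auto
  then have "degree p = Suc (degree q)"
    unfolding q by (subst degree_mult_eq) auto
  then have "k = degree q" using Suc.hyps by simp
  have ev: "M *v poly_vec M q w = l *s poly_vec M q w"
    using Suc.prems(2) unfolding q poly_vec_mult_linear by simp
  obtain b' where "\<And>t. F (((*v) M ^^ t) (poly_vec M q w)) \<le> b' * a ^ t"
    using decay_poly_vec[OF decay] by blast
  then have "poly_vec M q w = 0"
    using decaying_eigenvector_0[OF ev] eig[OF _ ev] by blast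
  then show ?case
    using Suc.hyps(1)[OF \<open>k = degree q\<close> \<open>q \<noteq> 0\<close>] by simp
qed

end

text \<open>Eigenvalues may be non-real, so the orbit is embedded in the complex space, with F the
  sum of N over real and imaginary parts.\<close>

lemma decaying_real_orbit_0:
  fixes A :: "real ^ 'n ^ 'n"
  assumes N: "is_norm N" and "0 \<le> \<alpha>" and eig: "\<alpha> < Min (cmod ` eigenvalues A)"
    and decay: "\<And>t. N (((*v) A ^^ t) d) \<le> b * \<alpha> ^ t"
  shows "d = 0"
proof -
  define M where "M = map_matrix complex_of_real A"
  define emb :: "real ^ 'n \<Rightarrow> complex ^ 'n" where "emb x = (\<chi> i. complex_of_real (x $ i))" for x
  define re :: "complex ^ 'n \<Rightarrow> real ^ 'n" where "re x = (\<chi> i. Re (x $ i))" for x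
  define im :: "complex ^ 'n \<Rightarrow> real ^ 'n" where "im x = (\<chi> i. Im (x $ i))" for x
  define F where "F x = N (re x) + N (im x)" for x
  have N_ge: "N x \<ge> 0" and N_0_iff: "N x = 0 \<longleftrightarrow> x = 0" and N_scale: "N (r *\<^sub>R x) = \<bar>r\<bar> * N x"
    and N_add: "N (x + y) \<le> N x + N y" for x y r
    using N by (auto simp: is_norm_def)
  have N_comb: "N (r *\<^sub>R x + s *\<^sub>R y) \<le> cmod z * N x + cmod z * N y"
    if "\<bar>r\<bar> \<le> cmod z" "\<bar>s\<bar> \<le> cmod z" for r s x y z
  proof -
    have "N (r *\<^sub>R x + s *\<^sub>R y) \<le> \<bar>r\<bar> * N x + \<bar>s\<bar> * N y"
      using N_add[of "r *\<^sub>R x" "s *\<^sub>R y"] by (simp add: N_scale)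
    also have "\<dots> \<le> cmod z * N x + cmod z * N y"
      using that N_ge by (intro add_mono mult_right_mono) auto
    finally show ?thesis .
  qed
  have F_add: "F (x + y) \<le> F x + F y" for x y
  proof -
    have "re (x + y) = re x + re y" "im (x + y) = im x + im y"
      by (simp_all add: re_def im_def vec_eq_iff)
    then show ?thesis
      using N_add[of "re x" "re y"] N_add[of "im x" "im y"] by (simp add: F_def)
  qed
  \<comment> \<open>Real and imaginary part of z x each combine those of x with coefficients of
    modulus at most |z|; adding the two bounds gives the factor 2.\<close>
  have F_scale: "F (z *s x) \<le> 2 * cmod z * F x" for z x
  proof -
    have "re (z *s x) = Re z *\<^sub>R re x + (- Im z) *\<^sub>R im x"
      "im (z *s x) = Im z *\<^sub>R re x + Re z *\<^sub>R im x"
      by (simp_all add: re_def im_def vec_eq_iff)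
    then have "F (z *s x) \<le> (cmod z * N (re x) + cmod z * N (im x)) + (cmod z * N (re x) + cmod z * N (im x))"
      unfolding F_def using abs_Re_le_cmod[of z] abs_Im_le_cmod[of z]
      by (metis N_comb abs_minus_cancel add_mono)
    then show ?thesis by (simp add: F_def algebra_simps)
  qed
  have F_pos: "F x > 0" if "x \<noteq> 0" for x
  proof -
    have "re x \<noteq> 0 \<or> im x \<noteq> 0"
      using that by (auto simp: re_def im_def vec_eq_iff complex_eq_iff)
    then show ?thesis
      using N_ge[of "re x"] N_ge[of "im x"] N_0_iff[of "re x"] N_0_iff[of "im x"]
      unfolding F_def by linarith
  qed
  have re_im_0: "re 0 = 0" "im 0 = 0" and re_emb: "re (emb x) = x" and im_emb: "im (emb x) = 0" for x
    by (simp_all add: re_def im_def emb_def vec_eq_iff)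
  have F_0: "F 0 = 0"
    using N_0_iff[of 0] by (simp add: F_def re_im_0)
  have "M *v emb x = emb (A *v x)" for x
    by (simp add: M_def emb_def vec_eq_iff matrix_vector_mult_def map_matrix_def)
  then have orbit: "((*v) M ^^ t) (emb d) = emb (((*v) A ^^ t) d)" for t
    by (induction t) simp_all
  have emb_decay: "F (((*v) M ^^ t) (emb d)) \<le> b * \<alpha> ^ t" for t
    using decay[of t] N_0_iff[of 0] by (simp add: orbit F_def re_emb im_emb)
  have large: "\<alpha> < cmod l" if "v \<noteq> 0" "M *v v = l *s v" for l v
  proof -
    have "l \<in> eigenvalues A"
      using that by (auto simp: eigenvalues_def M_def)
    then have "Min (cmod ` eigenvalues A) \<le> cmod l"
      using finite_eigenvalues by (intro Min_le) auto
    then show ?thesis using eig by linarith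
  qed
  obtain p where p: "p \<noteq> 0" "\<And>v. poly_vec M p v = 0"
    using annihilating_poly_exists[of M] by metis
  have "emb d = 0"
    using decaying_orbit_0[OF F_add F_scale F_pos F_0 _ \<open>0 \<le> \<alpha>\<close> large emb_decay p] by simp
  then show ?thesis
    using re_emb[of d] re_im_0 by simp
qed

section \<open>The control system\<close>

text \<open>Equal outputs before t yield equal inputs, so the feedback terms cancel and only the
  linear part acts on the difference.\<close>

lemma sys_state_diff:
  assumes "\<And>s. s < t \<Longrightarrow> sys_output A B C K x e s = sys_output A B C K x' e' s"
  shows "sys_state A B C K x e t - sys_state A B C K x' e' t = ((*v) A ^^ t) (x - x')"
  using assms
proof (induction t)
  case 0
  then show ?case by simp
next
  case (Suc t)
  have "map (sys_output A B C K x e) [0..<Suc t] = map (sys_output A B C K x' e') [0..<Suc t]"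
    using Suc.prems by (intro map_cong) auto
  then have "sys_state A B C K x e (Suc t) - sys_state A B C K x' e' (Suc t)
      = A *v (sys_state A B C K x e t - sys_state A B C K x' e' t)"
    unfolding sys_state.simps sys_output_def
    by (simp only: matrix_vector_mult_diff_distrib add_diff_cancel_right)
  then show ?case using Suc by simp
qed

text \<open>The law K drops out of the comparison. One direction extracts information from equal
  outputs, the other serves to construct attacks that keep them equal.\<close>

lemma sys_outputs_eq_iff:
  "(\<forall>t<T. sys_output A B C K x e t = sys_output A B C K x' e' t)
    \<longleftrightarrow> (\<forall>t<T. e' t - e t = C *v ((*v) A ^^ t) (x - x'))"
proof -
  have step: "sys_output A B C K x e t = sys_output A B C K x' e' t
      \<longleftrightarrow> e' t - e t = C *v ((*v) A ^^ t) (x - x')"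
    if "\<forall>s<t. sys_output A B C K x e s = sys_output A B C K x' e' s" for t
  proof -
    have "C *v ((*v) A ^^ t) (x - x') = C *v sys_state A B C K x e t - C *v sys_state A B C K x' e' t"
      using sys_state_diff[of t A B C K x e x' e'] that
      by (simp flip: matrix_vector_mult_diff_distrib)
    then have "sys_output A B C K x e t - sys_output A B C K x' e' t
        = C *v ((*v) A ^^ t) (x - x') - (e' t - e t)"
      by (simp add: sys_output_def)
    then show ?thesis
      by (metis eq_iff_diff_eq_0)
  qed
  show ?thesis
  proof (induction T)
    case (Suc T)
    then show ?case
      using step[of T] by (metis less_Suc_eq)
  qed simp
qed

lemma split_by_support:
  fixes w :: "real ^ 'p"
  assumes "supp w \<subseteq> S \<union> S'"
  obtains u u' where "supp u \<subseteq> S" "supp u' \<subseteq> S'" "u' - u = w"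
proof
  \<comment> \<open>Here u' takes the coordinates of w in S', and u takes the negated remaining
    ones, which can be nonzero only in S.\<close>
  show "supp (\<chi> i. if i \<in> S' then 0 else - w $ i) \<subseteq> S"
    using assms by (auto simp: supp_def)
  show "supp (\<chi> i. if i \<in> S' then w $ i else 0) \<subseteq> S'"
    by (auto simp: supp_def)
  show "(\<chi> i. if i \<in> S' then w $ i else 0) - (\<chi> i. if i \<in> S' then 0 else - w $ i) = w"
    by (simp add: vec_eq_iff)
qed

text \<open>The decoder picks any initial state consistent with the outputs; by assumption there is
  only one.\<close>

lemma errors_correctableI:
  assumes "\<And>x x' es es'. \<lbrakk>es \<in> attack_seqs q T; es' \<in> attack_seqs q T;
      \<forall>t<T. sys_output A B C K x (\<lambda>t. es ! t) t = sys_output A B C K x' (\<lambda>t. es' ! t) t\<rbrakk> \<Longrightarrow> x = x'"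
  shows "errors_correctable A B C K q T"
proof -
  define D where "D ys = (SOME x. \<exists>es\<in>attack_seqs q T.
    map (sys_output A B C K x (\<lambda>t. es ! t)) [0..<T] = ys)" for ys
  have "D (map (sys_output A B C K x (\<lambda>t. es ! t)) [0..<T]) = x"
    if "es \<in> attack_seqs q T" for x es
    unfolding D_def
  proof (rule some_equality)
    show "\<exists>es'\<in>attack_seqs q T. map (sys_output A B C K x (\<lambda>t. es' ! t)) [0..<T]
        = map (sys_output A B C K x (\<lambda>t. es ! t)) [0..<T]"
      using that by blast
  next
    fix x' assume "\<exists>es'\<in>attack_seqs q T. map (sys_output A B C K x' (\<lambda>t. es' ! t)) [0..<T]
        = map (sys_output A B C K x (\<lambda>t. es ! t)) [0..<T]"
    then show "x' = x"
      using assms that by (auto simp: map_eq_conv)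
  qed
  then show ?thesis
    unfolding errors_correctable_def by blast
qed

theorem theorem1:
  fixes A :: "real ^ 'n ^ 'n" and B :: "real ^ 'm ^ 'n" and C :: "real ^ 'n ^ 'p"
    and q :: nat
    and K :: "nat \<Rightarrow> (real ^ 'p) list \<Rightarrow> real ^ 'm"
    and N :: "real ^ 'n \<Rightarrow> real"
    and \<kappa> \<alpha> :: real
  assumes "is_norm N"
    and "\<kappa> > 0" and "0 \<le> \<alpha>" and "\<alpha> < 1"
    and "\<alpha> < Min (cmod ` eigenvalues A)"
    and "\<And>(x0 :: real ^ 'n) (e :: nat \<Rightarrow> real ^ 'p) t.
           \<exists>S. card S \<le> q \<and> (\<forall>s. supp (e s) \<subseteq> S) \<Longrightarrow>
           N (sys_state A B C K x0 e t) \<le> \<kappa> * \<alpha> ^ t * N x0"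
  shows "errors_correctable A B C K q CARD('n)"
proof (rule errors_correctableI)
  fix x x' :: "real ^ 'n" and es es' :: "(real ^ 'p) list"
  assume "es \<in> attack_seqs q CARD('n)" "es' \<in> attack_seqs q CARD('n)"
    and "\<forall>t<CARD('n). sys_output A B C K x (\<lambda>t. es ! t) t = sys_output A B C K x' (\<lambda>t. es' ! t) t"
  then obtain S S' where S: "card S \<le> q" "\<And>t. t < CARD('n) \<Longrightarrow> supp (es ! t) \<subseteq> S"
    and S': "card S' \<le> q" "\<And>t. t < CARD('n) \<Longrightarrow> supp (es' ! t) \<subseteq> S'"
    and es: "\<And>t. t < CARD('n) \<Longrightarrow> es' ! t - es ! t = C *v ((*v) A ^^ t) (x - x')"
    by (auto simp: attack_seqs_def sys_outputs_eq_iff)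
  define V where "V = {z. supp (C *v z) \<subseteq> S \<union> S'}"
  have "subspace V"
    unfolding subspace_def
  proof (intro conjI ballI allI)
    show "0 \<in> V" by (simp add: V_def supp_def)
    show "y + z \<in> V" if "y \<in> V" "z \<in> V" for y z
      using that by (force simp: V_def supp_def matrix_vector_right_distrib)
    show "r *\<^sub>R y \<in> V" if "y \<in> V" for r y
      using that by (auto simp: V_def supp_def matrix_vector_mult_scaleR)
  qed
  moreover have "((*v) A ^^ t) (x - x') \<in> V" if "t < CARD('n)" for t
    using S(2)[OF that] S'(2)[OF that] es[OF that, symmetric] by (force simp: V_def supp_def)
  ultimately have "((*v) A ^^ t) (x - x') \<in> V" for t
    by (rule orbit_in_subspace)
  then have "\<exists>u u'. supp u \<subseteq> S \<and> supp u' \<subseteq> S' \<and> u' - u = C *v ((*v) A ^^ t) (x - x')" for t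
    unfolding V_def mem_Collect_eq by (metis split_by_support)
  \<comment> \<open>These attacks run over all times and are chosen afresh: they need not extend
    \<open>es\<close> and \<open>es'\<close>, since only the supports and the difference
    matter.\<close>
  then obtain e e' where e: "\<And>t. supp (e t) \<subseteq> S" and e': "\<And>t. supp (e' t) \<subseteq> S'"
    and ee': "\<And>t. e' t - e t = C *v ((*v) A ^^ t) (x - x')"
    by metis
  have N_diff: "N (y - z) \<le> N y + N z" for y z
  proof -
    have "N (y + (- 1) *\<^sub>R z) \<le> N y + N ((- 1) *\<^sub>R z)" "N ((- 1) *\<^sub>R z) = \<bar>- 1\<bar> * N z"
      using assms(1) unfolding is_norm_def by blast+
    then show ?thesis by simp
  qed
  \<comment> \<open>The constant adds the stability bounds of the two trajectories, whose states
    differ by this vector.\<close>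
  have "N (((*v) A ^^ t) (x - x')) \<le> (\<kappa> * (N x + N x')) * \<alpha> ^ t" for t
  proof -
    have "\<forall>s<t. sys_output A B C K x e s = sys_output A B C K x' e' s"
      by (simp add: sys_outputs_eq_iff ee')
    then have "N (((*v) A ^^ t) (x - x'))
        = N (sys_state A B C K x e t - sys_state A B C K x' e' t)"
      by (simp add: sys_state_diff)
    also have "\<dots> \<le> N (sys_state A B C K x e t) + N (sys_state A B C K x' e' t)"
      by (rule N_diff)
    also have "\<dots> \<le> \<kappa> * \<alpha> ^ t * N x + \<kappa> * \<alpha> ^ t * N x'"
      using e e' S(1) S'(1) by (intro add_mono assms(6)) blast+
    finally show ?thesis by (simp add: algebra_simps)
  qed
  then have "x - x' = 0"
    by (rule decaying_real_orbit_0[OF assms(1,3,5)])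
  then show "x = x'" by simp
qed

end
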